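(* Let $\boldsymbol{b} \in [0,\infty)^{\mathbb{N}}$ and $\varepsilon > 0$. Suppose that $\boldsymbol{b} \in \ell^p(\mathbb{N})$ for some $0 < p \leq 1$ but $\boldsymbol{b} \notin w\ell^r(\mathbb{N})$ for some $0 < r < p$. Then there are infinitely many linearly independent functions $f \in \mathcal{H}(\boldsymbol{b},\varepsilon)$ such that $$\limsup_{n \rightarrow \infty} \frac{\| f - f_n \|_{L^2_{\varrho}(\mathcal{U})}}{n^{\frac12-\frac1r}} = +\infty ,$$ where $f_n$ denotes a best $n$-term approximation to $f$.
   Context: Notation: $\mathbb{N} = \{1,2,\ldots\}$, $\mathbb{N}_0 = \mathbb{N}\cup\{0\}$, $\mathcal{U} = [-1,1]^{\mathbb{N}}$. Measure and basis. $\varrho$ is a probability measure on $[-1,1]$ which generates a unique sequence of orthonormal polynomials $\{\psi_\nu\}_{\nu\in\mathbb{N}_0} \subset L^2_\varrho([-1,1])$, i.e. $\langle \psi_\nu,\psi_{\nu'}\rangle = \delta_{\nu,\nu'}$ and $\mathrm{span}\{\psi_0,\ldots,\psi_n\}$ is the space of polynomials of degree at most $n$ for every $n$ (examples: the uniform measure, giving Legendre polynomials, and the Chebyshev (arcsine) measure, giving first-kind Chebyshev polynomials). By abuse of notation $\varrho = \varrho\times\varrho\times\cdots$ also denotes the infinite tensor-product probability measure on $\mathcal{U}$, and $L^2_\varrho(\mathcal{U})$ is the space of square-integrable functions $\mathcal{U}\to\mathbb{C}$. Let $\mathcal{F} = \{ \boldsymbol{\nu} = (\nu_i)_{i=1}^\infty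 \in \mathbb{N}_0^{\mathbb{N}} : |\{i : \nu_i\neq 0\}| < \infty\}$ and, for $\boldsymbol{\nu}\in\mathcal{F}$, $\Psi_{\boldsymbol{\nu}}(\boldsymbol{y}) = \prod_{i : \nu_i \neq 0} \psi_{\nu_i}(y_i)$. Then $\{\Psi_{\boldsymbol{\nu}}\}_{\boldsymbol{\nu}\in\mathcal{F}}$ is an orthonormal basis of $L^2_\varrho(\mathcal{U})$. Best $n$-term approximation. For $f\in L^2_\varrho(\mathcal{U})$ put $c_{\boldsymbol{\nu}} = \langle f,\Psi_{\boldsymbol{\nu}}\rangle_{L^2_\varrho(\mathcal{U})}$ and, for $S\subset\mathcal{F}$, $f_S = \sum_{\boldsymbol{\nu}\in S} c_{\boldsymbol{\nu}}\Psi_{\boldsymbol{\nu}}$. A best $n$-term approximation is $f_n = f_{S^*}$, where $S^*$ minimizes $\|f-f_S\|_{L^2_\varrho(\mathcal{U})}$ over all $S\subset\mathcal{F}$ with $|S| = n$ (i.e. $S^*$ collects $n$ largest coefficients in absolute value). Holomorphic functions. For $\rho>1$ the Bernstein ellipse is $\mathcal{E}_\rho = \{ (z+z^{-1})/2 : z\in\mathbb{C},\ 1\leq |z|\leq\rho\}\subset\mathbb{C}$, and $\mathcal{E}_1 = [-1,1]$. For $\boldsymbol{\rho}\in[1,\infty)^{\mathbb{N}}$, $\mathcal{E}_{\boldsymbol{\rho}} = \mathcal{E}_{\rho_1}\times\mathcal{E}_{\rho_2}\times\cdots\subset\mathbb{C}^{\mathbb{N}}$. Given $\boldsymbol{b}\in[0,\infty)^{\mathbb{N}}$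 and $\varepsilon>0$, let $\mathcal{R}_{\boldsymbol{b},\varepsilon}$ be the union of all $\mathcal{E}_{\boldsymbol{\rho}}$ with $\boldsymbol{\rho}\in[1,\infty)^{\mathbb{N}}$ satisfying $\sum_{i=1}^\infty \left(\frac{\rho_i+\rho_i^{-1}}{2}-1\right)b_i\leq\varepsilon$. A function $f:\mathcal{U}\to\mathbb{C}$ is $(\boldsymbol{b},\varepsilon)$-holomorphic if it (extends to a function that) is holomorphic in every $\mathcal{E}_{\boldsymbol{\rho}}$ with $\boldsymbol{\rho}$ satisfying this inequality. Holomorphy is understood with respect to each variable: at every point $\boldsymbol{z}$ of the region and for every $i$, the limit of $(f(\boldsymbol{z}+h\boldsymbol{e}_i)-f(\boldsymbol{z}))/h$ as $h\to0$, $h\in\mathbb{C}$, exists (as usual for closed sets, $f$ being defined in a neighbourhood of the point in the variable concerned). $\mathcal{H}(\boldsymbol{b},\varepsilon)\subset L^2_\varrho(\mathcal{U})$ is the set of $(\boldsymbol{b},\varepsilon)$-holomorphic functions $f$ with $\|f\|_{L^\infty(\mathcal{R}_{\boldsymbol{b},\varepsilon})}\leq 1$. Weak $\ell^p$ spaces. For a sequence $\boldsymbol{c}=(c_i)_{i=1}^\infty$ let $(c_i^* )_{i=1}^\infty$ be a nonincreasing rearrangement of $(|c_i|)_{i=1}^\infty$; $\|\boldsymbol{c}\|_{p,\infty} = \sup_{i\in\mathbb{N}} i^{1/p}c_i^*$, and $w\ell^p(\mathbb{N})$ is the set of sequences with $\|\boldsymbol{c}\|_{p,\infty}<\infty$.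 *)

theory Defs
  imports "HOL-Probability.Probability" "HOL-Computational_Algebra.Polynomial"
begin

text \<open>
  Sequences are indexed by \<open>nat\<close> starting at 0, so the \<open>i\<close>-th entry of a sequence indexed by
  \<open>{1, 2, \<dots>}\<close> is the entry \<open>i - 1\<close> here.
\<close>

section \<open>Measure and polynomial basis\<close>

text \<open>
  The basis polynomials are real, as usual for a measure on the real line, but their signs are
  not normalised.
\<close>

definition orthonormal_polynomials :: "real measure \<Rightarrow> (nat \<Rightarrow> real poly) \<Rightarrow> bool" where
  "orthonormal_polynomials \<mu> \<psi> \<longleftrightarrow>
     (\<forall>m n. (LINT x|\<mu>. poly (\<psi> m) x * poly (\<psi> n) x) = (if m = n then 1 else 0)) \<and>
     (\<forall>n. {(\<Sum>k\<le>n. smult (a k) (\<psi> k)) | a. True} = {q. degree q \<le> n})"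

text \<open>If \<open>space \<mu> = {-1..1}\<close>, the space of this measure is \<open>{y. \<forall>i. y i \<in> {-1..1}}\<close>.\<close>

definition tensor_measure :: "real measure \<Rightarrow> (nat \<Rightarrow> real) measure" where
  "tensor_measure \<mu> = PiM UNIV (\<lambda>_. \<mu>)"

definition square_integrable :: "'a measure \<Rightarrow> ('a \<Rightarrow> complex) set" where
  "square_integrable M =
     {f \<in> borel_measurable M. integrable M (\<lambda>x. (cmod (f x))\<^sup>2)}"

definition L2_inner :: "'a measure \<Rightarrow> ('a \<Rightarrow> complex) \<Rightarrow> ('a \<Rightarrow> complex) \<Rightarrow> complex" where
  "L2_inner M f g = (LINT x|M. f x * cnj (g x))"

definition L2_norm :: "'a measure \<Rightarrow> ('a \<Rightarrow> complex) \<Rightarrow> real" where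
  "L2_norm M f = sqrt (LINT x|M. (cmod (f x))\<^sup>2)"

definition multi_indices :: "(nat \<Rightarrow> nat) set" where
  "multi_indices = {\<nu>. finite {i. \<nu> i \<noteq> 0}}"

definition tensor_poly :: "(nat \<Rightarrow> real poly) \<Rightarrow> (nat \<Rightarrow> nat) \<Rightarrow> (nat \<Rightarrow> real) \<Rightarrow> complex" where
  "tensor_poly \<psi> \<nu> y = (\<Prod>i | \<nu> i \<noteq> 0. complex_of_real (poly (\<psi> (\<nu> i)) (y i)))"

section \<open>Best \<open>n\<close>-term approximation\<close>

definition poly_coeff ::
  "real measure \<Rightarrow> (nat \<Rightarrow> real poly) \<Rightarrow> ((nat \<Rightarrow> real) \<Rightarrow> complex) \<Rightarrow> (nat \<Rightarrow> nat) \<Rightarrow> complex" where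
  "poly_coeff \<mu> \<psi> f \<nu> = L2_inner (tensor_measure \<mu>) f (tensor_poly \<psi> \<nu>)"

definition poly_truncation ::
  "real measure \<Rightarrow> (nat \<Rightarrow> real poly) \<Rightarrow> ((nat \<Rightarrow> real) \<Rightarrow> complex) \<Rightarrow> (nat \<Rightarrow> nat) set
     \<Rightarrow> (nat \<Rightarrow> real) \<Rightarrow> complex" where
  "poly_truncation \<mu> \<psi> f S y = (\<Sum>\<nu>\<in>S. poly_coeff \<mu> \<psi> f \<nu> * tensor_poly \<psi> \<nu> y)"

definition n_term_index_sets :: "nat \<Rightarrow> (nat \<Rightarrow> nat) set set" where
  "n_term_index_sets n = {S. S \<subseteq> multi_indices \<and> finite S \<and> card S = n}"

definition best_n_term_approximation ::
  "real measure \<Rightarrow> (nat \<Rightarrow> real poly) \<Rightarrow> ((nat \<Rightarrow> real) \<Rightarrow> complex) \<Rightarrow> nat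
     \<Rightarrow> ((nat \<Rightarrow> real) \<Rightarrow> complex) \<Rightarrow> bool" where
  "best_n_term_approximation \<mu> \<psi> f n g \<longleftrightarrow>
     (\<exists>S\<in>n_term_index_sets n.
        g = poly_truncation \<mu> \<psi> f S \<and>
        (\<forall>S'\<in>n_term_index_sets n.
           L2_norm (tensor_measure \<mu>) (\<lambda>y. f y - poly_truncation \<mu> \<psi> f S y)
             \<le> L2_norm (tensor_measure \<mu>) (\<lambda>y. f y - poly_truncation \<mu> \<psi> f S' y)))"

section \<open>Holomorphic functions of infinitely many variables\<close>

definition bernstein_ellipse :: "real \<Rightarrow> complex set" where
  "bernstein_ellipse \<rho> =
     (if \<rho> = 1 then complex_of_real ` {-1..1}
      else {(z + inverse z) / 2 | z. 1 \<le> cmod z \<and> cmod z \<le> \<rho>})"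

definition bernstein_polyellipse :: "(nat \<Rightarrow> real) \<Rightarrow> (nat \<Rightarrow> complex) set" where
  "bernstein_polyellipse \<rho> = {z. \<forall>i. z i \<in> bernstein_ellipse (\<rho> i)}"

definition admissible :: "(nat \<Rightarrow> real) \<Rightarrow> real \<Rightarrow> (nat \<Rightarrow> real) set" where
  "admissible b \<epsilon> =
     {\<rho>. (\<forall>i. 1 \<le> \<rho> i) \<and>
         summable (\<lambda>i. ((\<rho> i + inverse (\<rho> i)) / 2 - 1) * b i) \<and>
         (\<Sum>i. ((\<rho> i + inverse (\<rho> i)) / 2 - 1) * b i) \<le> \<epsilon>}"

definition holomorphy_region :: "(nat \<Rightarrow> real) \<Rightarrow> real \<Rightarrow> (nat \<Rightarrow> complex) set" where
  "holomorphy_region b \<epsilon> = (\<Union>\<rho>\<in>admissible b \<epsilon>. bernstein_polyellipse \<rho>)"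

text \<open>
  The derivative is the unrestricted complex one also at points where \<open>z i\<close> lies on the boundary
  of its ellipse. Since \<open>F\<close> is total, it is defined near such points; only the values of \<open>F\<close>
  near the region, in one variable at a time, matter.
\<close>

definition separately_holomorphic_on ::
  "((nat \<Rightarrow> complex) \<Rightarrow> complex) \<Rightarrow> (nat \<Rightarrow> complex) set \<Rightarrow> bool" where
  "separately_holomorphic_on F D \<longleftrightarrow>
     (\<forall>z\<in>D. \<forall>i. (\<lambda>w. F (z(i := w))) field_differentiable (at (z i)))"

text \<open>
  \<open>F\<close> is the holomorphic extension of \<open>f\<close>. Membership in \<open>L\<^sup>2\<close> is a separate requirement, because
  in infinitely many variables separate holomorphy does not imply measurability. Only the
  restriction of \<open>f\<close> to the space of \<open>tensor_measure \<mu>\<close> is relevant.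
\<close>

definition holomorphic_class ::
  "real measure \<Rightarrow> (nat \<Rightarrow> real) \<Rightarrow> real \<Rightarrow> ((nat \<Rightarrow> real) \<Rightarrow> complex) set" where
  "holomorphic_class \<mu> b \<epsilon> =
     {f \<in> square_integrable (tensor_measure \<mu>).
        \<exists>F. (\<forall>y. (\<forall>i. y i \<in> {-1..1}) \<longrightarrow> F (\<lambda>i. complex_of_real (y i)) = f y) \<and>
            (\<forall>\<rho>\<in>admissible b \<epsilon>. separately_holomorphic_on F (bernstein_polyellipse \<rho>)) \<and>
            (SUP z\<in>holomorphy_region b \<epsilon>. ereal (cmod (F z))) \<le> 1}"

text \<open>Linear independence in \<open>L\<^sup>2(M)\<close>, that is, of the classes modulo almost everywhere equality.\<close>

definition L2_independent :: "'a measure \<Rightarrow> ('a \<Rightarrow> complex) set \<Rightarrow> bool" where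
  "L2_independent M A \<longleftrightarrow>
     (\<forall>B a. finite B \<and> B \<subseteq> A \<and> (AE x in M. (\<Sum>f\<in>B. a f * f x) = 0) \<longrightarrow> (\<forall>f\<in>B. a f = 0))"

section \<open>Sequence spaces\<close>

definition lp_space :: "real \<Rightarrow> (nat \<Rightarrow> real) set" where
  "lp_space p = {c. summable (\<lambda>i. \<bar>c i\<bar> powr p)}"

text \<open>
  The nonzero terms of \<open>\<bar>c\<bar>\<close> are listed in nonincreasing order, each as often as it occurs; if
  there are only finitely many, the list is continued by zeros. When \<open>c\<close> has infinitely many
  nonzero terms, its zero terms have no place in such a list, whence the bijection is only
  between the supports.
\<close>

definition nonincreasing_rearrangement :: "(nat \<Rightarrow> real) \<Rightarrow> (nat \<Rightarrow> real) \<Rightarrow> bool" where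
  "nonincreasing_rearrangement c d \<longleftrightarrow>
     decseq d \<and> (\<forall>i. 0 \<le> d i) \<and>
     (\<exists>\<pi>. bij_betw \<pi> {i. d i \<noteq> 0} {j. c j \<noteq> 0} \<and> (\<forall>i. d i \<noteq> 0 \<longrightarrow> d i = \<bar>c (\<pi> i)\<bar>))"

text \<open>
  Every null sequence has a nonincreasing rearrangement; sequences without one do not tend to 0
  and so lie in no weak \<open>\<ell>\<^sup>p\<close> space.
\<close>

definition weak_lp_space :: "real \<Rightarrow> (nat \<Rightarrow> real) set" where
  "weak_lp_space p =
     {c. \<exists>d. nonincreasing_rearrangement c d \<and>
             (SUP i. ereal (real (Suc i) powr (1 / p) * d i)) < \<infinity>}"

end

theory Submission
  imports Defs
begin

text \<open>
  The functions are linear forms. Let \<open>C = 1 / (\<epsilon> + \<Sum>j. b\<^sub>j)\<close>; the sum is finite because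
  \<open>p \<le> 1\<close>. On an admissible polyellipse the variable \<open>z\<^sub>j\<close> is bounded by the semi-axis
  \<open>a\<^sub>j = (\<rho>\<^sub>j + \<rho>\<^sub>j\<^sup>-\<^sup>1) / 2\<close>, and admissibility means \<open>\<Sum>j. (a\<^sub>j - 1) b\<^sub>j \<le> \<epsilon>\<close>. Hence
  \<open>C \<Sum>j. b\<^sub>j z\<^sub>j\<close> converges absolutely there, is affine in each variable and bounded by 1, so it
  belongs to the holomorphic class (\<open>linear_form_on_polyellipse\<close>, \<open>linear_form_holomorphic\<close>).
  
  Its coefficient at the \<open>j\<close>-th unit multi-index is \<open>C b\<^sub>j\<close> times a fixed nonzero number, the
  inner product of \<open>x\<close> and \<open>\<psi>\<^sub>1\<close> (\<open>linear_form_coeff\<close>, \<open>slope_nonzero\<close>). Thus the coefficients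
  decay no faster than \<open>b\<close>. As \<open>b\<close> is not in weak \<open>\<ell>\<^sup>r\<close>, for every \<open>K\<close> there are arbitrarily large
  \<open>n\<close> for which at least \<open>2 n\<close> terms of \<open>b\<close> exceed \<open>K n\<^sup>-\<^sup>1\<^sup>/\<^sup>r\<close>
  (\<open>many_large_terms_if_not_weak_lp\<close>). Any truncation with \<open>n\<close> terms misses at least \<open>n\<close> of the
  corresponding coefficients, so by Bessel's inequality its error is at least a constant times
  \<open>K n\<^sup>1\<^sup>/\<^sup>2\<^sup>-\<^sup>1\<^sup>/\<^sup>r\<close> (\<open>projection_error_lower_bound\<close>, \<open>limsup_best_n_term_error\<close>).
  
  Infinitely many independent functions arise by halving one weight: the \<open>k\<close>-th function, for \<open>k\<close> in
  the infinite support of \<open>b\<close>, has the weight \<open>C b\<^sub>k / 2\<close> at \<open>k\<close> and \<open>C b\<^sub>j\<close> elsewhere. This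
  changes no coefficient by more than a factor 2, and the coefficient vectors are linearly independent
  (\<open>halved_family_independent\<close>).
\<close>

section \<open>Rearrangements and weak \<open>\<ell>\<^sup>p\<close> spaces\<close>

text \<open>
  A strict total order in which every element of \<open>S\<close> has finitely many predecessors has order
  type at most \<open>\<omega>\<close>, and the number of predecessors is the place of an element in its enumeration.
  This treats finite and infinite \<open>S\<close> alike.
\<close>

lemma initial_segment_positions:
  fixes prec :: "nat \<Rightarrow> nat \<Rightarrow> bool" and S :: "nat set" and position :: "nat \<Rightarrow> nat"
  assumes position: "\<And>i. position i = card {j\<in>S. prec j i}"
    and irrefl: "irreflp prec" and trans: "transp prec" and total: "totalp prec"
    and fin: "\<forall>i\<in>S. finite {j\<in>S. prec j i}"
  shows "inj_on position S"
    and "\<And>m n. n \<in> position ` S \<Longrightarrow> m \<le> n \<Longrightarrow> m \<in> position ` S"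
    and "\<And>i j. i \<in> S \<Longrightarrow> j \<in> S \<Longrightarrow> prec j i \<Longrightarrow> position j < position i"
proof -
  show less: "position j < position i" if "i \<in> S" "j \<in> S" "prec j i" for i j
  proof -
    have "{k\<in>S. prec k j} \<subset> {k\<in>S. prec k i}"
      using that irrefl trans by (auto dest: transpD irreflpD)
    then show ?thesis
      unfolding position using fin \<open>i \<in> S\<close> by (intro psubset_card_mono) auto
  qed
  then show inj: "inj_on position S"
    by (metis inj_onI less_irrefl total totalpD)
  show "m \<in> position ` S" if n: "n \<in> position ` S" and "m \<le> n" for m n
  proof (cases "m = n")
    case False
    obtain i where i: "i \<in> S" "n = position i" using n by auto
    \<comment> \<open>The \<open>position i\<close> predecessors of \<open>i\<close> have distinct positions below \<open>position i\<close>, so they take them all.\<close>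
    have "position ` {j\<in>S. prec j i} = {..<position i}"
    proof (rule card_subset_eq)
      show "position ` {j\<in>S. prec j i} \<subseteq> {..<position i}" using less i by auto
      have "card (position ` {j\<in>S. prec j i}) = card {j\<in>S. prec j i}"
        by (rule card_image) (rule inj_on_subset[OF inj], auto)
      then show "card (position ` {j\<in>S. prec j i}) = card {..<position i}" by (simp add: position)
    qed simp
    then have "m \<in> position ` {j\<in>S. prec j i}" using False that i by auto
    then show ?thesis by blast
  qed (use that in simp)
qed

text \<open>
  The support of \<open>c\<close> is enumerated by decreasing \<open>\<bar>c j\<bar>\<close>, ties being broken by the index. Since
  \<open>c\<close> tends to 0, only finitely many entries come before a given nonzero one.
\<close>

lemma nonincreasing_rearrangement_exists:
  fixes c :: "nat \<Rightarrow> real"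
  assumes "c \<longlonglongrightarrow> 0"
  shows "\<exists>d. nonincreasing_rearrangement c d"
proof -
  define S where "S = {j. c j \<noteq> 0}"
  define prec where "prec = (\<lambda>j i. \<bar>c i\<bar> < \<bar>c j\<bar> \<or> \<bar>c j\<bar> = \<bar>c i\<bar> \<and> j < i)"
  define position where "position = (\<lambda>i. card {j\<in>S. prec j i})"
  have fin: "finite {j\<in>S. prec j i}" if "i \<in> S" for i
  proof -
    have "\<forall>\<^sub>F j in sequentially. \<bar>c j\<bar> < \<bar>c i\<bar>"
      using assms that unfolding S_def
      by (intro order_tendstoD(2)[OF tendsto_rabs_zero]) auto
    then have "finite {j. \<not> \<bar>c j\<bar> < \<bar>c i\<bar>}"
      by (simp add: cofinite_eq_sequentially[symmetric] eventually_cofinite)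
    then show ?thesis by (rule finite_subset[rotated]) (auto simp: prec_def)
  qed
  have "irreflp prec" "transp prec" "totalp prec"
    by (auto simp: prec_def intro!: irreflpI transpI totalpI)
  note R = initial_segment_positions[of position S prec, OF _ this]
  have position: "position i = card {j\<in>S. prec j i}" for i by (simp add: position_def)
  note R = R[OF position ballI[OF fin]]
  define \<pi> where "\<pi> = inv_into S position"
  define d where "d = (\<lambda>n. if n \<in> position ` S then \<bar>c (\<pi> n)\<bar> else 0)"
  have \<pi>S: "\<pi> n \<in> S" "position (\<pi> n) = n" if "n \<in> position ` S" for n
    using that unfolding \<pi>_def by (auto intro: inv_into_into f_inv_into_f)
  have supp: "{n. d n \<noteq> 0} = position ` S"
    using \<pi>S(1) by (auto simp: d_def S_def)
  have "decseq d"
    unfolding decseq_def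
  proof (intro allI impI)
    fix m n :: nat assume "m \<le> n"
    show "d n \<le> d m"
    proof (cases "n \<in> position ` S")
      case True
      then have m: "m \<in> position ` S" using R(2) \<open>m \<le> n\<close> by blast
      have "\<not> prec (\<pi> n) (\<pi> m)"
        using R(3)[of "\<pi> m" "\<pi> n"] \<pi>S[OF True] \<pi>S[OF m] \<open>m \<le> n\<close> by auto
      then show ?thesis using True m by (auto simp: d_def prec_def)
    qed (simp add: d_def)
  qed
  moreover have "bij_betw \<pi> {n. d n \<noteq> 0} {j. c j \<noteq> 0}"
    unfolding supp \<pi>_def S_def[symmetric]
    by (rule bij_betw_inv_into) (simp add: bij_betw_def R(1))
  moreover have "\<forall>n. d n \<noteq> 0 \<longrightarrow> d n = \<bar>c (\<pi> n)\<bar>" "\<forall>n. 0 \<le> d n"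
    by (auto simp: d_def)
  ultimately show ?thesis unfolding nonincreasing_rearrangement_def by blast
qed

text \<open>
  This is the form in which the failure of weak \<open>\<ell>\<^sup>r\<close> summability is used. A set of \<open>n\<close> indices misses
  at least \<open>n\<close> of the \<open>2 n\<close> indices in \<open>T\<close>, which is why \<open>T\<close> has twice as many elements as the
  number \<open>n\<close> in the threshold.
\<close>

lemma many_large_terms_if_not_weak_lp:
  fixes c :: "nat \<Rightarrow> real"
  assumes lim: "c \<longlonglongrightarrow> 0" and r: "0 < r" and nw: "c \<notin> weak_lp_space r" and K: "0 < K"
  shows "\<exists>n\<ge>N. \<exists>T. finite T \<and> card T = 2 * n \<and> (\<forall>j\<in>T. K * real n powr (- 1 / r) < \<bar>c j\<bar>)"
proof (rule ccontr)
  assume neg: "\<not> ?thesis"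
  obtain d where nr: "nonincreasing_rearrangement c d"
    using nonincreasing_rearrangement_exists[OF lim] by blast
  then obtain \<pi> where dec: "decseq d" and d0: "\<And>i. 0 \<le> d i"
    and bij: "bij_betw \<pi> {i. d i \<noteq> 0} {j. c j \<noteq> 0}"
    and d_eq: "\<And>i. d i \<noteq> 0 \<Longrightarrow> d i = \<bar>c (\<pi> i)\<bar>"
    unfolding nonincreasing_rearrangement_def by blast
  have bound: "d (2 * n - 1) \<le> K * real n powr (- 1 / r)" if "N \<le> n" for n
  proof (rule ccontr)
    assume "\<not> ?thesis"
    then have large: "K * real n powr (- 1 / r) < d i" if "i < 2 * n" for i
      using decseqD[OF dec, of i "2 * n - 1"] that by linarith
    have pos: "0 \<le> K * real n powr (- 1 / r)" using K by simp
    have sub: "{..<2 * n} \<subseteq> {i. d i \<noteq> 0}"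
      using large pos by force
    have "card (\<pi> ` {..<2 * n}) = 2 * n"
      using card_image[OF inj_on_subset[OF bij_betw_imp_inj_on[OF bij] sub]] by simp
    moreover have "K * real n powr (- 1 / r) < \<bar>c j\<bar>" if j: "j \<in> \<pi> ` {..<2 * n}" for j
    proof -
      obtain i where i: "i < 2 * n" "j = \<pi> i" using j by auto
      then have "d i \<noteq> 0" using sub by auto
      with d_eq[of i] large[of i] i show ?thesis by simp
    qed
    ultimately show False using neg \<open>N \<le> n\<close> by (metis finite_imageI finite_lessThan)
  qed
  \<comment> \<open>The bound on \<open>d (2 * n - 1)\<close> extends to all later entries by monotonicity: \<open>d m\<close> is compared with
    \<open>n = Suc m div 2\<close>, and \<open>Suc m \<le> 3 * n\<close> costs the factor \<open>3 powr (1 / r)\<close>.\<close>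
  define N' where "N' = N + 1"
  define B where "B = max (real (2 * N') powr (1 / r) * d 0) (3 powr (1 / r) * K)"
  have "real (Suc m) powr (1 / r) * d m \<le> B" for m
  proof (cases "Suc m \<le> 2 * N'")
    case True
    have "real (Suc m) powr (1 / r) * d m \<le> real (2 * N') powr (1 / r) * d 0"
    proof (rule mult_mono)
      show "real (Suc m) powr (1 / r) \<le> real (2 * N') powr (1 / r)"
        using True r by (intro powr_mono2) (auto simp del: of_nat_Suc of_nat_mult)
      show "d m \<le> d 0" using decseqD[OF dec] by simp
    qed (use d0 in auto)
    then show ?thesis by (simp add: B_def)
  next
    case False
    define n where "n = Suc m div 2"
    have n: "N \<le> n" "1 \<le> n" "2 * n - 1 \<le> m" "Suc m \<le> 3 * n"
      using False by (auto simp: n_def N'_def)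
    have "real (Suc m) powr (1 / r) * d m \<le> real (3 * n) powr (1 / r) * (K * real n powr (- 1 / r))"
    proof (rule mult_mono)
      show "real (Suc m) powr (1 / r) \<le> real (3 * n) powr (1 / r)"
        using n(4) r by (intro powr_mono2) (auto simp del: of_nat_Suc of_nat_mult)
      show "d m \<le> K * real n powr (- 1 / r)"
        using decseqD[OF dec n(3)] bound[OF n(1)] by linarith
    qed (use d0 in auto)
    also have "\<dots> = 3 powr (1 / r) * K"
      using n(2) by (simp add: powr_mult powr_minus field_simps)
    finally show ?thesis by (simp add: B_def)
  qed
  then have "(SUP m. ereal (real (Suc m) powr (1 / r) * d m)) \<le> ereal B"
    by (intro SUP_least) (simp del: of_nat_Suc)
  then have "(SUP m. ereal (real (Suc m) powr (1 / r) * d m)) < \<infinity>"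
    using ereal_infty_less_eq2(1) less_ereal.simps(4) order_le_less_trans by blast
  then have "c \<in> weak_lp_space r" unfolding weak_lp_space_def using nr by blast
  with nw show False by blast
qed

text \<open>
  The terms are eventually at most 1, and since \<open>p \<le> 1\<close>, numbers in \<open>[0, 1]\<close> are at most their \<open>p\<close>-th powers.
\<close>

lemma summable_if_lp:
  fixes c :: "nat \<Rightarrow> real"
  assumes "c \<in> lp_space p" "0 < p" "p \<le> 1"
  shows "summable (\<lambda>i. \<bar>c i\<bar>)"
proof -
  have s: "summable (\<lambda>i. \<bar>c i\<bar> powr p)" using assms by (simp add: lp_space_def)
  have "\<forall>\<^sub>F i in sequentially. \<bar>c i\<bar> powr p < 1"
    using summable_LIMSEQ_zero[OF s] by (rule order_tendstoD) simp
  then have "\<forall>\<^sub>F i in sequentially. norm \<bar>c i\<bar> \<le> \<bar>c i\<bar> powr p"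
  proof eventually_elim
    case (elim i)
    show ?case
    proof (cases "c i = 0")
      case False
      have "\<bar>c i\<bar> \<le> 1"
      proof (rule ccontr)
        assume "\<not> \<bar>c i\<bar> \<le> 1"
        then have "1 \<le> \<bar>c i\<bar> powr p" using assms by (intro ge_one_powr_ge_zero) auto
        with elim show False by simp
      qed
      then have "\<bar>c i\<bar> powr 1 \<le> \<bar>c i\<bar> powr p" using False assms by (intro powr_mono') auto
      then show ?thesis using False by simp
    qed simp
  qed
  then show ?thesis using s by (rule summable_comparison_test_ev)
qed

section \<open>Orthonormal families and \<open>n\<close>-term approximation\<close>

lemma integrable_mult_cnj:
  fixes f g :: "'a \<Rightarrow> complex"
  assumes "f \<in> square_integrable M" "g \<in> square_integrable M"
  shows "integrable M (\<lambda>x. f x * cnj (g x))"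
proof (rule Bochner_Integration.integrable_bound)
  show "integrable M (\<lambda>x. (cmod (f x))\<^sup>2 + (cmod (g x))\<^sup>2)"
    using assms by (auto simp: square_integrable_def)
  show "(\<lambda>x. f x * cnj (g x)) \<in> borel_measurable M"
  proof -
    have [measurable]: "f \<in> borel_measurable M" "g \<in> borel_measurable M"
      using assms by (auto simp: square_integrable_def)
    have "(\<lambda>x. cnj (g x)) \<in> borel_measurable M"
      by (rule borel_measurable_continuous_on[OF continuous_on_cnj[OF continuous_on_id]]) simp
    then show ?thesis by measurable
  qed
  have "cmod (f x * cnj (g x)) \<le> (cmod (f x))\<^sup>2 + (cmod (g x))\<^sup>2" for x
  proof -
    have "0 \<le> cmod (f x) * cmod (g x)" by simp
    then show ?thesis
      using sum_squares_bound[of "cmod (f x)" "cmod (g x)"] unfolding norm_mult complex_mod_cnj by linarith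
  qed
  then show "AE x in M. norm (f x * cnj (g x)) \<le> norm ((cmod (f x))\<^sup>2 + (cmod (g x))\<^sup>2)"
    by simp
qed

lemma square_integrable_add:
  assumes "f \<in> square_integrable M" "g \<in> square_integrable M"
  shows "(\<lambda>x. f x + g x) \<in> square_integrable M"
proof -
  have [measurable]: "f \<in> borel_measurable M" "g \<in> borel_measurable M"
    using assms by (auto simp: square_integrable_def)
  have "integrable M (\<lambda>x. (cmod (f x + g x))\<^sup>2)"
  proof (rule Bochner_Integration.integrable_bound)
    show "integrable M (\<lambda>x. 2 * (cmod (f x))\<^sup>2 + 2 * (cmod (g x))\<^sup>2)"
      using assms by (auto simp: square_integrable_def)
    have "(cmod (f x + g x))\<^sup>2 \<le> 2 * (cmod (f x))\<^sup>2 + 2 * (cmod (g x))\<^sup>2" for x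
    proof -
      have "(cmod (f x + g x))\<^sup>2 \<le> (cmod (f x) + cmod (g x))\<^sup>2"
        by (intro power_mono norm_triangle_ineq) simp
      then show ?thesis
        using sum_squares_bound[of "cmod (f x)" "cmod (g x)"] by (simp add: power2_sum)
    qed
    then show "AE x in M. norm ((cmod (f x + g x))\<^sup>2) \<le> norm (2 * (cmod (f x))\<^sup>2 + 2 * (cmod (g x))\<^sup>2)"
      by simp
  qed measurable
  then show ?thesis by (simp add: square_integrable_def)
qed

lemma square_integrable_sum:
  assumes "\<And>i. i \<in> S \<Longrightarrow> g i \<in> square_integrable M"
  shows "(\<lambda>x. \<Sum>i\<in>S. a i * g i x) \<in> square_integrable M"
  using assms
proof (induction S rule: infinite_finite_induct)
  case (insert i S)
  have "(\<lambda>x. a i * g i x) \<in> square_integrable M"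
    using insert.prems[of i] by (auto simp: square_integrable_def norm_mult power_mult_distrib)
  with insert show ?case by (simp add: square_integrable_add)
qed (auto simp: square_integrable_def)

definition orthonormal_family :: "'a measure \<Rightarrow> 'i set \<Rightarrow> ('i \<Rightarrow> 'a \<Rightarrow> complex) \<Rightarrow> bool" where
  "orthonormal_family M I \<Phi> \<longleftrightarrow>
     (\<forall>i\<in>I. \<Phi> i \<in> square_integrable M) \<and>
     (\<forall>i\<in>I. \<forall>j\<in>I. L2_inner M (\<Phi> i) (\<Phi> j) = (if i = j then 1 else 0))"

lemma L2_norm_sq: "(L2_norm M f)\<^sup>2 = (LINT x|M. (cmod (f x))\<^sup>2)"
  by (simp add: L2_norm_def)

text \<open>
  Pythagoras. Everything about best approximation follows from this identity, since it reduces the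
  error of an \<open>n\<close>-term truncation to a sum of squared coefficients.
\<close>

lemma L2_norm_diff_projection:
  assumes on: "orthonormal_family M I \<Phi>" and f: "f \<in> square_integrable M"
    and S: "finite S" "S \<subseteq> I"
  shows "(L2_norm M (\<lambda>x. f x - (\<Sum>i\<in>S. L2_inner M f (\<Phi> i) * \<Phi> i x)))\<^sup>2
         = (L2_norm M f)\<^sup>2 - (\<Sum>i\<in>S. (cmod (L2_inner M f (\<Phi> i)))\<^sup>2)"
proof -
  define c where "c i = L2_inner M f (\<Phi> i)" for i
  define g where "g = (\<lambda>x. \<Sum>i\<in>S. c i * \<Phi> i x)"
  have \<Phi>: "\<Phi> i \<in> square_integrable M" if "i \<in> S" for i
    using on S that by (auto simp: orthonormal_family_def)
  have g: "g \<in> square_integrable M"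
    unfolding g_def by (rule square_integrable_sum) (rule \<Phi>)
  have inner_g: "(LINT x|M. h x * cnj (g x)) = (\<Sum>i\<in>S. cnj (c i) * L2_inner M h (\<Phi> i))"
    if h: "h \<in> square_integrable M" for h
  proof -
    have "(LINT x|M. h x * cnj (g x)) = (LINT x|M. (\<Sum>i\<in>S. cnj (c i) * (h x * cnj (\<Phi> i x))))"
      by (simp add: g_def sum_distrib_left mult_ac)
    also have "\<dots> = (\<Sum>i\<in>S. cnj (c i) * L2_inner M h (\<Phi> i))"
      unfolding L2_inner_def
      by (subst Bochner_Integration.integral_sum) (auto intro!: integrable_mult_cnj h \<Phi>)
    finally show ?thesis .
  qed
  have "L2_inner M g (\<Phi> i) = c i" if "i \<in> S" for i
  proof -
    have "L2_inner M g (\<Phi> i) = (LINT x|M. (\<Sum>j\<in>S. c j * (\<Phi> j x * cnj (\<Phi> i x))))"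
      by (simp add: L2_inner_def g_def sum_distrib_right mult.assoc)
    also have "\<dots> = (\<Sum>j\<in>S. c j * L2_inner M (\<Phi> j) (\<Phi> i))"
      unfolding L2_inner_def using that
      by (subst Bochner_Integration.integral_sum) (auto intro!: integrable_mult_cnj \<Phi>)
    also have "\<dots> = (\<Sum>j\<in>S. if j = i then c j else 0)"
    proof (intro sum.cong refl)
      fix j assume "j \<in> S"
      with \<open>i \<in> S\<close> S have "i \<in> I" "j \<in> I" by auto
      with on have "L2_inner M (\<Phi> j) (\<Phi> i) = (if j = i then 1 else 0)"
        unfolding orthonormal_family_def by blast
      then show "c j * L2_inner M (\<Phi> j) (\<Phi> i) = (if j = i then c j else 0)" by simp
    qed
    finally show ?thesis using S that by simp
  qed
  note gi = this
  have sq: "cnj z * z = of_real ((cmod z)\<^sup>2)" for z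
    by (subst complex_norm_square) (rule mult.commute)
  have gg: "(LINT x|M. g x * cnj (g x)) = of_real (\<Sum>i\<in>S. (cmod (c i))\<^sup>2)"
    unfolding inner_g[OF g] of_real_sum by (intro sum.cong refl) (simp only: sq gi)
  have fg: "(LINT x|M. f x * cnj (g x)) = of_real (\<Sum>i\<in>S. (cmod (c i))\<^sup>2)"
    unfolding inner_g[OF f] of_real_sum
    by (intro sum.cong refl) (simp only: sq c_def)
  have "(LINT x|M. (cmod (f x - g x))\<^sup>2)
        = (LINT x|M. (cmod (f x))\<^sup>2 - 2 * Re (f x * cnj (g x)) + Re (g x * cnj (g x)))"
    by (intro Bochner_Integration.integral_cong refl)
       (simp only: cmod_power2, simp add: power2_eq_square algebra_simps)
  also have "\<dots> = (LINT x|M. (cmod (f x))\<^sup>2) - 2 * Re (LINT x|M. f x * cnj (g x))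
                    + Re (LINT x|M. g x * cnj (g x))"
    using f integrable_mult_cnj[OF f g] integrable_mult_cnj[OF g g]
    by (simp add: square_integrable_def del: times_complex.sel)
  also have "\<dots> = (LINT x|M. (cmod (f x))\<^sup>2) - (\<Sum>i\<in>S. (cmod (c i))\<^sup>2)"
    unfolding fg gg by simp
  finally show ?thesis by (simp add: L2_norm_sq g_def c_def)
qed

lemma Bessel_inequality:
  assumes "orthonormal_family M I \<Phi>" "f \<in> square_integrable M" "finite S" "S \<subseteq> I"
  shows "(\<Sum>i\<in>S. (cmod (L2_inner M f (\<Phi> i)))\<^sup>2) \<le> (L2_norm M f)\<^sup>2"
proof -
  have "0 \<le> (L2_norm M (\<lambda>x. f x - (\<Sum>i\<in>S. L2_inner M f (\<Phi> i) * \<Phi> i x)))\<^sup>2" by simp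
  then show ?thesis unfolding L2_norm_diff_projection[OF assms] by simp
qed

text \<open>
  At least \<open>n\<close> of the \<open>2 n\<close> large coefficients lie outside \<open>S\<close>, and by Bessel's inequality each of
  them contributes to the squared error.
\<close>

lemma projection_error_lower_bound:
  assumes on: "orthonormal_family M I \<Phi>" and f: "f \<in> square_integrable M"
    and S: "finite S" "S \<subseteq> I" "card S = n"
    and T: "finite T" "T \<subseteq> I" "card T = 2 * n"
    and large: "\<And>i. i \<in> T \<Longrightarrow> s \<le> (cmod (L2_inner M f (\<Phi> i)))\<^sup>2" and "0 \<le> s"
  shows "real n * s \<le> (L2_norm M (\<lambda>x. f x - (\<Sum>i\<in>S. L2_inner M f (\<Phi> i) * \<Phi> i x)))\<^sup>2"
proof -
  have "n \<le> card (T - S)" using diff_card_le_card_Diff[OF S(1), of T] S T by simp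
  then have "real n * s \<le> real (card (T - S)) * s"
    using \<open>0 \<le> s\<close> by (intro mult_right_mono) auto
  also have "\<dots> \<le> (\<Sum>i\<in>T - S. (cmod (L2_inner M f (\<Phi> i)))\<^sup>2)"
    by (rule sum_bounded_below) (use large in auto)
  also have "\<dots> = (\<Sum>i\<in>S \<union> T. (cmod (L2_inner M f (\<Phi> i)))\<^sup>2) - (\<Sum>i\<in>S. (cmod (L2_inner M f (\<Phi> i)))\<^sup>2)"
    using S T by (subst sum_diff[symmetric]) (auto intro!: sum.cong)
  also have "\<dots> \<le> (L2_norm M f)\<^sup>2 - (\<Sum>i\<in>S. (cmod (L2_inner M f (\<Phi> i)))\<^sup>2)"
    using Bessel_inequality[OF on f, of "S \<union> T"] S T by simp
  finally show ?thesis using L2_norm_diff_projection[OF on f S(1,2)] by simp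
qed

text \<open>
  Greedy choice: the complement of a finite set always has an element of maximal weight, because only
  finitely many weights exceed a given positive one.
\<close>

lemma dominant_subset_exists:
  fixes g :: "'i \<Rightarrow> real"
  assumes inf: "infinite I" and fin: "\<And>t. 0 < t \<Longrightarrow> finite {i\<in>I. t \<le> g i}"
    and nonneg: "\<And>i. i \<in> I \<Longrightarrow> 0 \<le> g i"
  shows "\<exists>S. S \<subseteq> I \<and> finite S \<and> card S = n \<and> (\<forall>i\<in>S. \<forall>j\<in>I - S. g j \<le> g i)"
proof (induction n)
  case (Suc n)
  then obtain S where S: "S \<subseteq> I" "finite S" "card S = n" "\<And>i j. i \<in> S \<Longrightarrow> j \<in> I - S \<Longrightarrow> g j \<le> g i"
    by blast
  obtain k where k: "k \<in> I - S" "\<And>j. j \<in> I - S \<Longrightarrow> g j \<le> g k"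
  proof (cases "\<exists>i\<in>I - S. 0 < g i")
    case True
    then obtain i where i: "i \<in> I - S" "0 < g i" by blast
    define A where "A = {j\<in>I - S. g i \<le> g j}"
    have A: "finite A" "A \<noteq> {}"
      using i finite_subset[OF _ fin[OF i(2)], of A] by (auto simp: A_def)
    then obtain k where "k \<in> A" and "Max (g ` A) = g k" by (rule obtains_MAX)
    then have kmax: "g j \<le> g k" if "j \<in> A" for j
      using A that by (metis Max_ge finite_imageI imageI)
    have "k \<in> I - S" "g i \<le> g k" using \<open>k \<in> A\<close> by (auto simp: A_def)
    moreover have "g j \<le> g k" if "j \<in> I - S" for j
    proof (cases "g i \<le> g j")
      case True
      with that have "j \<in> A" by (simp add: A_def)
      then show ?thesis by (rule kmax)
    next
      case False
      with \<open>g i \<le> g k\<close> show ?thesis by linarith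
    qed
    ultimately show ?thesis using that by blast
  next
    case False
    obtain k where k: "k \<in> I - S" using inf S(2) by (metis Diff_eq_empty_iff equals0I finite_subset)
    have "g j \<le> g k" if "j \<in> I - S" for j
      using False that nonneg[of k] k by (meson DiffD1 linorder_not_le order_trans)
    with k show ?thesis by (rule that)
  qed
  show ?case
    by (rule exI[of _ "insert k S"]) (use S k in auto)
qed auto

text \<open>
  The parts of \<open>S\<close> and \<open>S'\<close> outside their intersection have the same size and are separated by the
  smallest weight in \<open>S - S'\<close>.
\<close>

lemma sum_le_dominant_sum:
  fixes g :: "'i \<Rightarrow> real"
  assumes "finite S" "finite S'" "card S' = card S"
    and dom: "\<And>i j. i \<in> S \<Longrightarrow> j \<in> S' - S \<Longrightarrow> g j \<le> g i"
  shows "sum g S' \<le> sum g S"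
proof -
  have card: "card (S' - S) = card (S - S')"
    using assms(1-3) by (metis card_Diff_subset_Int finite_Int inf_commute)
  have "sum g (S' - S) \<le> sum g (S - S')"
  proof (cases "S - S' = {}")
    case True
    then have "card (S' - S) = 0" using card by (metis card.empty)
    then have "S' - S = {}" using assms(2) by (metis card_0_eq finite_Diff)
    with True show ?thesis by (metis order_refl)
  next
    case False
    define m where "m = Min (g ` (S - S'))"
    have "sum g (S' - S) \<le> real (card (S' - S)) * m"
      unfolding m_def using assms(1) False
      by (intro sum_bounded_above) (auto intro: dom)
    also have "\<dots> \<le> sum g (S - S')"
      unfolding card m_def by (rule sum_bounded_below) (use assms(1) in auto)
    finally show ?thesis .
  qed
  then show ?thesis
    using sum.Int_Diff[OF assms(1), of g S'] sum.Int_Diff[OF assms(2), of g S]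
    by (simp add: Int_commute)
qed

text \<open>
  By Bessel's inequality only finitely many coefficients exceed a given positive bound, so there is a
  set of \<open>n\<close> largest coefficients, and by Pythagoras such a set is optimal.
\<close>

lemma best_projection_exists:
  assumes on: "orthonormal_family M I \<Phi>" and f: "f \<in> square_integrable M" and inf: "infinite I"
  shows "\<exists>S. S \<subseteq> I \<and> finite S \<and> card S = n \<and>
     (\<forall>S'. S' \<subseteq> I \<and> finite S' \<and> card S' = n \<longrightarrow>
        L2_norm M (\<lambda>x. f x - (\<Sum>i\<in>S. L2_inner M f (\<Phi> i) * \<Phi> i x))
          \<le> L2_norm M (\<lambda>x. f x - (\<Sum>i\<in>S'. L2_inner M f (\<Phi> i) * \<Phi> i x)))"
proof -
  define g where "g i = (cmod (L2_inner M f (\<Phi> i)))\<^sup>2" for i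
  have "finite {i\<in>I. t \<le> g i}" if t: "0 < t" for t
  proof (rule ccontr)
    assume "infinite {i\<in>I. t \<le> g i}"
    moreover obtain m where m: "(L2_norm M f)\<^sup>2 / t < real m" using reals_Archimedean2 by blast
    ultimately obtain B where B: "finite B" "card B = m" "B \<subseteq> {i\<in>I. t \<le> g i}"
      using infinite_arbitrarily_large by blast
    have "real m * t \<le> sum g B" using sum_bounded_below[of B t g] B by auto
    also have "\<dots> \<le> (L2_norm M f)\<^sup>2"
      unfolding g_def using B by (intro Bessel_inequality[OF on f]) auto
    finally show False using m t by (simp add: field_simps)
  qed
  from dominant_subset_exists[OF inf this, of n]
  obtain S where S: "S \<subseteq> I" "finite S" "card S = n" "\<forall>i\<in>S. \<forall>j\<in>I - S. g j \<le> g i"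
    by (auto simp: g_def)
  have "L2_norm M (\<lambda>x. f x - (\<Sum>i\<in>S. L2_inner M f (\<Phi> i) * \<Phi> i x))
          \<le> L2_norm M (\<lambda>x. f x - (\<Sum>i\<in>S'. L2_inner M f (\<Phi> i) * \<Phi> i x))"
    if S': "S' \<subseteq> I" "finite S'" "card S' = n" for S'
  proof (rule power2_le_imp_le)
    have "sum g S' \<le> sum g S"
      by (rule sum_le_dominant_sum) (use S S' in auto)
    then show "(L2_norm M (\<lambda>x. f x - (\<Sum>i\<in>S. L2_inner M f (\<Phi> i) * \<Phi> i x)))\<^sup>2
          \<le> (L2_norm M (\<lambda>x. f x - (\<Sum>i\<in>S'. L2_inner M f (\<Phi> i) * \<Phi> i x)))\<^sup>2"
      using S S' by (simp add: L2_norm_diff_projection[OF on f] g_def)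
  qed (simp add: L2_norm_def)
  then show ?thesis using S by blast
qed

section \<open>Tensor products of the orthonormal polynomials\<close>

locale polynomial_basis =
  fixes \<mu> :: "real measure" and \<psi> :: "nat \<Rightarrow> real poly"
  assumes prob: "prob_space \<mu>"
    and sets_eq: "sets \<mu> = sets (restrict_space borel {-1..1})"
    and orthonormal: "orthonormal_polynomials \<mu> \<psi>"
begin

interpretation prob_space \<mu> by (rule prob)

lemma space_eq: "space \<mu> = {-1..1}"
  using sets_eq_imp_space_eq[OF sets_eq] by (simp add: space_restrict_space)

lemma product_prob: "product_prob_space (\<lambda>_ :: nat. \<mu>)"
  by (rule product_prob_spaceI) (rule prob)

lemma prob_tensor: "prob_space (tensor_measure \<mu>)"
proof -
  interpret product_prob_space "\<lambda>_ :: nat. \<mu>" UNIV by (rule product_prob)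
  show ?thesis unfolding tensor_measure_def by unfold_locales
qed

lemma space_tensor: "space (tensor_measure \<mu>) = {y. \<forall>i. y i \<in> {-1..1}}"
  by (auto simp: tensor_measure_def space_PiM space_eq)

lemma measurable_id: "(\<lambda>x. x) \<in> borel_measurable \<mu>"
  by (subst measurable_cong_sets[OF sets_eq refl]) (rule measurable_restrict_space1, simp)

lemma measurable_poly: "(\<lambda>x. poly q x) \<in> borel_measurable \<mu>"
  by (rule measurable_compose[OF measurable_id])
     (auto intro!: borel_measurable_continuous_onI continuous_intros)

lemma measurable_poly_coordinate:
  assumes "i \<in> J"
  shows "(\<lambda>y. complex_of_real (poly q (y i))) \<in> borel_measurable (PiM J (\<lambda>_. \<mu>))"
proof (rule measurable_compose[of "\<lambda>y. y i" _ \<mu> "\<lambda>x. complex_of_real (poly q x)"])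
  show "(\<lambda>x. complex_of_real (poly q x)) \<in> borel_measurable \<mu>"
    by (rule measurable_compose[OF measurable_id])
       (auto intro!: borel_measurable_continuous_onI continuous_intros)
qed (use assms in simp)

lemma poly_bound:
  obtains B where "0 \<le> B" "\<And>x. x \<in> {-1..1} \<Longrightarrow> \<bar>poly q x\<bar> \<le> (B :: real)"
proof -
  have "compact (poly q ` {-1..1 :: real})"
    by (intro compact_continuous_image continuous_intros) simp
  then obtain B where "\<And>y. y \<in> poly q ` {-1..1 :: real} \<Longrightarrow> norm y \<le> B"
    using compact_imp_bounded bounded_iff by metis
  then have "\<And>x. x \<in> {-1..1} \<Longrightarrow> \<bar>poly q x\<bar> \<le> max 0 B" by (force simp: max_def)
  then show ?thesis by (intro that[of "max 0 B"]) auto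
qed

lemma integrable_poly: "integrable \<mu> (\<lambda>x. poly q x)"
proof -
  obtain B where "\<And>x. x \<in> {-1..1} \<Longrightarrow> \<bar>poly q x\<bar> \<le> B" using poly_bound[of q] by blast
  then show ?thesis
    by (intro integrable_const_bound[of _ B] measurable_poly AE_I2) (auto simp: space_eq)
qed

lemma orthonormalD: "(LINT x|\<mu>. poly (\<psi> m) x * poly (\<psi> n) x) = (if m = n then 1 else 0)"
  using orthonormal by (simp add: orthonormal_polynomials_def)

lemma span_eq: "{(\<Sum>k\<le>n. smult (a k) (\<psi> k)) | a. True} = {q. degree q \<le> n}"
  using orthonormal by (simp add: orthonormal_polynomials_def)

text \<open>
  The sign of \<open>\<psi> 0\<close> is not determined, so it need not be the constant 1.
\<close>

lemma psi0_constant: obtains u where "\<psi> 0 = [:u:]" "u * u = 1"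
proof -
  have "\<psi> 0 \<in> {(\<Sum>k\<le>0. smult (a k) (\<psi> k)) | a. True}"
    by (auto intro!: exI[of _ "\<lambda>_. 1"])
  then have "degree (\<psi> 0) = 0" unfolding span_eq by simp
  then obtain u where u: "\<psi> 0 = [:u:]" by (rule degree_eq_zeroE)
  with orthonormalD[of 0 0] have "u * u = 1" by (simp add: prob_space)
  with u show ?thesis by (rule that)
qed

text \<open>
  The product defining \<open>tensor_poly\<close> skips the indices with \<open>\<nu> i = 0\<close>, which amounts to replacing the
  factor \<open>\<psi> 0\<close>, possibly \<open>-1\<close>, by 1. With this replacement the product may be taken over any finite
  set that contains the support of \<open>\<nu>\<close>.
\<close>

definition basis_poly :: "nat \<Rightarrow> real poly" where
  "basis_poly k = (if k = 0 then 1 else \<psi> k)"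

lemma basis_poly_orthonormal:
  "(LINT x|\<mu>. poly (basis_poly m) x * poly (basis_poly n) x) = (if m = n then 1 else 0)"
proof -
  obtain u where u: "\<psi> 0 = [:u:]" "u * u = 1" by (rule psi0_constant)
  have "u \<noteq> 0" using u(2) by auto
  have mean: "(LINT x|\<mu>. poly (\<psi> k) x) = 0" if "k \<noteq> 0" for k
    using orthonormalD[of 0 k] that \<open>u \<noteq> 0\<close> by (simp add: u(1))
  show ?thesis
    by (auto simp: basis_poly_def mean orthonormalD prob_space)
qed

lemma tensor_poly_eq_prod:
  assumes "finite J" "{i. \<nu> i \<noteq> 0} \<subseteq> J"
  shows "tensor_poly \<psi> \<nu> y = (\<Prod>i\<in>J. complex_of_real (poly (basis_poly (\<nu> i)) (y i)))"
  unfolding tensor_poly_def using assms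
  by (intro prod.mono_neutral_cong_left) (auto simp: basis_poly_def)

text \<open>
  Fubini's theorem for functions of finitely many coordinates: the projection to these coordinates
  carries the infinite product measure to the finite one.
\<close>

lemma integral_tensor_prod:
  fixes g :: "nat \<Rightarrow> real poly"
  assumes "finite J"
  shows "(LINT y|tensor_measure \<mu>. (\<Prod>i\<in>J. complex_of_real (poly (g i) (y i))))
         = (\<Prod>i\<in>J. complex_of_real (LINT x|\<mu>. poly (g i) x))"
proof -
  interpret product_prob_space "\<lambda>_ :: nat. \<mu>" UNIV by (rule product_prob)
  have meas: "(\<lambda>y. \<Prod>i\<in>J. complex_of_real (poly (g i) (y i))) \<in> borel_measurable (PiM J (\<lambda>_. \<mu>))"
    by (intro borel_measurable_prod measurable_poly_coordinate)
  have "(LINT y|tensor_measure \<mu>. (\<Prod>i\<in>J. complex_of_real (poly (g i) (y i))))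
        = (LINT y|tensor_measure \<mu>. (\<Prod>i\<in>J. complex_of_real (poly (g i) (restrict y J i))))"
    by simp
  also have "\<dots> = (LINT y|distr (PiM UNIV (\<lambda>_. \<mu>)) (PiM J (\<lambda>_. \<mu>)) (\<lambda>y. restrict y J).
                     (\<Prod>i\<in>J. complex_of_real (poly (g i) (y i))))"
    unfolding tensor_measure_def
    by (rule integral_distr[symmetric]) (rule measurable_restrict_subset[OF subset_UNIV] meas)+
  also have "\<dots> = (LINT y|PiM J (\<lambda>_. \<mu>). (\<Prod>i\<in>J. complex_of_real (poly (g i) (y i))))"
    using assms by (subst distr_PiM_restrict_finite) auto
  also have "\<dots> = (\<Prod>i\<in>J. (LINT x|\<mu>. complex_of_real (poly (g i) x)))"
    using assms by (intro product_integral_prod) (auto intro: integrable_poly)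
  finally show ?thesis by simp
qed

lemma tensor_poly_measurable:
  assumes "\<nu> \<in> multi_indices"
  shows "tensor_poly \<psi> \<nu> \<in> borel_measurable (tensor_measure \<mu>)"
proof -
  have "(\<lambda>y. complex_of_real (poly (\<psi> (\<nu> i)) (y i))) \<in> borel_measurable (tensor_measure \<mu>)" for i
    unfolding tensor_measure_def by (rule measurable_poly_coordinate) simp
  then have "(\<lambda>y. \<Prod>i | \<nu> i \<noteq> 0. complex_of_real (poly (\<psi> (\<nu> i)) (y i)))
               \<in> borel_measurable (tensor_measure \<mu>)"
    by (intro borel_measurable_prod)
  then show ?thesis by (simp add: tensor_poly_def[abs_def])
qed

lemma tensor_poly_bound:
  obtains B where "0 \<le> B" "\<And>y. y \<in> space (tensor_measure \<mu>) \<Longrightarrow> cmod (tensor_poly \<psi> \<nu> y) \<le> B"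
proof -
  have "\<exists>B. \<forall>k. 0 \<le> B k \<and> (\<forall>x\<in>{-1..1}. \<bar>poly (\<psi> k) x\<bar> \<le> (B k :: real))"
    by (rule choice) (metis poly_bound)
  then obtain B where B: "\<And>k. 0 \<le> B k" "\<And>k x. x \<in> {-1..1} \<Longrightarrow> \<bar>poly (\<psi> k) x\<bar> \<le> (B k :: real)"
    by blast
  show ?thesis
  proof (rule that)
    show "0 \<le> (\<Prod>i | \<nu> i \<noteq> 0. B (\<nu> i))" by (intro prod_nonneg) (simp add: B)
    fix y assume "y \<in> space (tensor_measure \<mu>)"
    then have "\<And>i. y i \<in> {-1..1}" by (simp add: space_tensor)
    then show "cmod (tensor_poly \<psi> \<nu> y) \<le> (\<Prod>i | \<nu> i \<noteq> 0. B (\<nu> i))"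
      unfolding tensor_poly_def prod_norm[symmetric]
      by (intro prod_mono) (simp add: B del: atLeastAtMost_iff)
  qed
qed

lemma bounded_square_integrable:
  assumes "f \<in> borel_measurable (tensor_measure \<mu>)"
    and "\<And>y. y \<in> space (tensor_measure \<mu>) \<Longrightarrow> cmod (f y) \<le> B"
  shows "f \<in> square_integrable (tensor_measure \<mu>)"
proof -
  interpret T: prob_space "tensor_measure \<mu>" by (rule prob_tensor)
  have "integrable (tensor_measure \<mu>) (\<lambda>y. (cmod (f y))\<^sup>2)"
    using assms
    by (intro T.integrable_const_bound[of _ "B\<^sup>2"] AE_I2) (auto intro!: power_mono)
  then show ?thesis using assms by (simp add: square_integrable_def)
qed

text \<open>
  Both polynomials are products over the union of the two supports; the integral factorises, and a
  coordinate in which the multi-indices differ gives a factor 0.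
\<close>

lemma tensor_poly_orthonormal:
  "orthonormal_family (tensor_measure \<mu>) multi_indices (tensor_poly \<psi>)"
  unfolding orthonormal_family_def
proof (intro conjI ballI)
  fix \<nu> :: "nat \<Rightarrow> nat" assume "\<nu> \<in> multi_indices"
  then show "tensor_poly \<psi> \<nu> \<in> square_integrable (tensor_measure \<mu>)"
    by (metis bounded_square_integrable tensor_poly_bound tensor_poly_measurable)
next
  fix \<nu> \<kappa> :: "nat \<Rightarrow> nat" assume "\<nu> \<in> multi_indices" "\<kappa> \<in> multi_indices"
  define J where "J = {i. \<nu> i \<noteq> 0} \<union> {i. \<kappa> i \<noteq> 0}"
  have J: "finite J" "{i. \<nu> i \<noteq> 0} \<subseteq> J" "{i. \<kappa> i \<noteq> 0} \<subseteq> J"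
    using \<open>\<nu> \<in> _\<close> \<open>\<kappa> \<in> _\<close> by (auto simp: J_def multi_indices_def)
  have "L2_inner (tensor_measure \<mu>) (tensor_poly \<psi> \<nu>) (tensor_poly \<psi> \<kappa>)
        = (LINT y|tensor_measure \<mu>.
             (\<Prod>i\<in>J. complex_of_real (poly (basis_poly (\<nu> i) * basis_poly (\<kappa> i)) (y i))))"
    unfolding L2_inner_def tensor_poly_eq_prod[OF J(1,2)] tensor_poly_eq_prod[OF J(1,3)]
    by (simp add: prod.distrib)
  also have "\<dots> = (\<Prod>i\<in>J. complex_of_real (if \<nu> i = \<kappa> i then 1 else 0))"
    unfolding integral_tensor_prod[OF J(1)]
    unfolding poly_mult basis_poly_orthonormal ..
  also have "\<dots> = (if \<nu> = \<kappa> then 1 else 0)"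
  proof (cases "\<nu> = \<kappa>")
    case False
    then obtain i where "\<nu> i \<noteq> \<kappa> i" by blast
    then have "i \<in> J" by (auto simp: J_def)
    with \<open>\<nu> i \<noteq> \<kappa> i\<close> J(1) False show ?thesis by (auto intro!: prod_zero)
  qed simp
  finally show "L2_inner (tensor_measure \<mu>) (tensor_poly \<psi> \<nu>) (tensor_poly \<psi> \<kappa>)
    = (if \<nu> = \<kappa> then 1 else 0)" .
qed

text \<open>
  The coefficient \<open>a\<close> in \<open>x = m + a \<psi>\<^sub>1(x)\<close>, where \<open>m\<close> is the mean of \<open>\<mu>\<close>.
\<close>

definition slope :: real where
  "slope = (LINT x|\<mu>. x * poly (\<psi> 1) x)"

text \<open>
  Otherwise the identity would be a multiple of the constant \<open>\<psi> 0\<close>.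
\<close>

lemma slope_nonzero: "slope \<noteq> 0"
proof
  assume "slope = 0"
  have "[:0, 1:] \<in> {(\<Sum>k\<le>1. smult (a k) (\<psi> k)) | a. True}" unfolding span_eq by simp
  then obtain a where "[:0, 1:] = (\<Sum>k\<le>1. smult (a k) (\<psi> k))" by blast
  then have a: "[:0, 1:] = smult (a 0) (\<psi> 0) + smult (a 1) (\<psi> 1)" by simp
  obtain u where u: "\<psi> 0 = [:u:]" by (rule psi0_constant)
  have x: "x = a 0 * poly (\<psi> 0) x + a 1 * poly (\<psi> 1) x" for x
    using arg_cong[OF a, of "\<lambda>q. poly q x"] by simp
  have "slope = (LINT x|\<mu>. a 0 * poly (\<psi> 0 * \<psi> 1) x + a 1 * poly (\<psi> 1 * \<psi> 1) x)"
    unfolding slope_def by (subst (1) x) (simp add: algebra_simps)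
  also have "\<dots> = a 0 * (LINT x|\<mu>. poly (\<psi> 0 * \<psi> 1) x) + a 1 * (LINT x|\<mu>. poly (\<psi> 1 * \<psi> 1) x)"
    by (subst Bochner_Integration.integral_add) (auto intro: integrable_poly simp del: poly_mult)
  also have "\<dots> = a 1" unfolding poly_mult orthonormalD by simp
  finally have "[:0, 1:] = smult (a 0) (\<psi> 0)" using \<open>slope = 0\<close> a by simp
  then show False by (simp add: u)
qed

definition unit_index :: "nat \<Rightarrow> nat \<Rightarrow> nat" where
  "unit_index i = (\<lambda>_. 0)(i := 1)"

lemma unit_index: "unit_index i \<in> multi_indices" "inj unit_index"
  by (auto simp: unit_index_def multi_indices_def inj_def fun_eq_iff split: if_splits)

lemma tensor_poly_unit_index:
  "tensor_poly \<psi> (unit_index i) y = complex_of_real (poly (\<psi> 1) (y i))"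
proof -
  have "{j. unit_index i j \<noteq> 0} = {i}" by (auto simp: unit_index_def)
  then show ?thesis by (simp add: tensor_poly_def unit_index_def)
qed

lemma coordinate_coeff:
  "(LINT y|tensor_measure \<mu>. complex_of_real (y j) * complex_of_real (poly (\<psi> 1) (y i)))
   = (if i = j then of_real slope else 0)"
proof (cases "i = j")
  case True
  show ?thesis using integral_tensor_prod[of "{i}" "\<lambda>_. [:0, 1:] * \<psi> 1"] True
    by (simp add: slope_def)
next
  case False
  have "(LINT x|\<mu>. poly (\<psi> 1) x) = 0"
    using basis_poly_orthonormal[of 0 1] by (simp add: basis_poly_def)
  then show ?thesis
    using integral_tensor_prod[of "{i, j}" "\<lambda>k. if k = i then \<psi> 1 else [:0, 1:]"] False
    by (simp add: mult.commute)
qed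

end

section \<open>Linear forms on Bernstein polyellipses\<close>

text \<open>
  The right-hand side is the larger semi-axis of the ellipse; it is this quantity, minus 1, that the
  admissibility condition on \<open>\<rho>\<close> weighs with \<open>b\<close>.
\<close>

lemma norm_bernstein_ellipse_le:
  assumes "z \<in> bernstein_ellipse \<rho>" "1 \<le> \<rho>"
  shows "cmod z \<le> (\<rho> + inverse \<rho>) / 2"
proof (cases "\<rho> = 1")
  case True
  with assms show ?thesis by (auto simp: bernstein_ellipse_def)
next
  case False
  with assms obtain w where w: "z = (w + inverse w) / 2" "1 \<le> cmod w" "cmod w \<le> \<rho>"
    by (auto simp: bernstein_ellipse_def)
  have "cmod z \<le> (cmod w + inverse (cmod w)) / 2"
    using norm_triangle_ineq[of w "inverse w"] unfolding w(1) by (simp add: norm_divide norm_inverse)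
  moreover have "cmod w + inverse (cmod w) \<le> \<rho> + inverse \<rho>"
  proof -
    \<comment> \<open>The product is the increment of \<open>t + 1 / t\<close> from \<open>t = cmod w\<close> to \<open>t = \<rho>\<close>.\<close>
    have "0 \<le> (\<rho> - cmod w) * (1 - inverse (cmod w * \<rho>))"
    proof (rule mult_nonneg_nonneg)
      have "1 * 1 \<le> cmod w * \<rho>" using w assms(2) by (intro mult_mono) auto
      then show "0 \<le> 1 - inverse (cmod w * \<rho>)" using inverse_le_1_iff[of "cmod w * \<rho>"] by simp
    qed (use w in simp)
    also have "\<dots> = \<rho> + inverse \<rho> - (cmod w + inverse (cmod w))"
    proof -
      have "cmod w \<noteq> 0" "\<rho> \<noteq> 0" using w(2) assms(2) by auto
      then show ?thesis by (simp add: field_simps)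
    qed
    finally show ?thesis by simp
  qed
  ultimately show ?thesis by simp
qed

definition linear_form :: "(nat \<Rightarrow> real) \<Rightarrow> (nat \<Rightarrow> complex) \<Rightarrow> complex" where
  "linear_form w z = (\<Sum>j. complex_of_real (w j) * z j)"

text \<open>
  Admissibility says exactly that the semi-axes \<open>a\<^sub>j\<close> satisfy \<open>\<Sum>j. (a\<^sub>j - 1) b\<^sub>j \<le> \<epsilon>\<close>, hence
  \<open>\<Sum>j. a\<^sub>j b\<^sub>j \<le> \<epsilon> + \<Sum>j. b\<^sub>j\<close>. So a linear form with weights dominated by \<open>b\<close> is bounded
  uniformly over all admissible polyellipses.
\<close>

lemma linear_form_on_polyellipse:
  assumes b: "\<forall>i. 0 \<le> b i" "summable b" and w: "\<And>j. \<bar>w j\<bar> \<le> C * b j"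
    and \<rho>: "\<rho> \<in> admissible b \<epsilon>" and z: "z \<in> bernstein_polyellipse \<rho>" and "0 \<le> C"
  shows "summable (\<lambda>j. cmod (complex_of_real (w j) * z j))"
    and "cmod (linear_form w z) \<le> C * (\<epsilon> + (\<Sum>j. b j))"
proof -
  define h where "h j = ((\<rho> j + inverse (\<rho> j)) / 2 - 1) * b j" for j
  have h: "summable h" "suminf h \<le> \<epsilon>" and \<rho>1: "\<And>j. 1 \<le> \<rho> j"
    using \<rho> by (auto simp: admissible_def h_def[abs_def])
  have termwise: "cmod (complex_of_real (w j) * z j) \<le> C * (h j + b j)" for j
  proof -
    have "cmod (z j) \<le> (\<rho> j + inverse (\<rho> j)) / 2"
      using z \<rho>1 by (intro norm_bernstein_ellipse_le) (auto simp: bernstein_polyellipse_def)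
    then have "\<bar>w j\<bar> * cmod (z j) \<le> C * b j * ((\<rho> j + inverse (\<rho> j)) / 2)"
      using w[of j] b(1) \<open>0 \<le> C\<close> by (intro mult_mono) auto
    then show ?thesis by (simp add: norm_mult h_def algebra_simps)
  qed
  have sum: "summable (\<lambda>j. C * (h j + b j))"
    using h b by (intro summable_mult summable_add)
  show s: "summable (\<lambda>j. cmod (complex_of_real (w j) * z j))"
    by (rule summable_comparison_test'[OF sum, of 0]) (use termwise in simp)
  have "cmod (linear_form w z) \<le> (\<Sum>j. cmod (complex_of_real (w j) * z j))"
    unfolding linear_form_def by (rule summable_norm[OF s])
  also have "\<dots> \<le> (\<Sum>j. C * (h j + b j))"
    by (rule suminf_le[OF termwise s sum])
  also have "\<dots> = C * (suminf h + suminf b)"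
    using h b by (simp add: suminf_mult suminf_add summable_add)
  also have "\<dots> \<le> C * (\<epsilon> + (\<Sum>j. b j))"
    using h \<open>0 \<le> C\<close> by (intro mult_left_mono) auto
  finally show "cmod (linear_form w z) \<le> C * (\<epsilon> + (\<Sum>j. b j))" .
qed

text \<open>
  As a function of a single variable the form is affine.
\<close>

lemma linear_form_update:
  assumes "summable (\<lambda>j. complex_of_real (w j) * z j)"
  shows "linear_form w (z(i := v)) = linear_form w z + complex_of_real (w i) * (v - z i)"
proof -
  have "(\<lambda>j. complex_of_real (w j) * z j + (if j = i then complex_of_real (w i) * (v - z i) else 0))
        sums (linear_form w z + complex_of_real (w i) * (v - z i))"
    unfolding linear_form_def
    by (intro sums_add summable_sums assms sums_single)
  moreover have "(\<lambda>j. complex_of_real (w j) * z j + (if j = i then complex_of_real (w i) * (v - z i) else 0))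
        = (\<lambda>j. complex_of_real (w j) * (z(i := v)) j)"
    by (auto simp: algebra_simps)
  ultimately show ?thesis unfolding linear_form_def[of w "z(i := v)"] by (simp add: sums_iff)
qed

lemma linear_form_holomorphic:
  assumes "\<forall>i. 0 \<le> b i" "summable b" "\<And>j. \<bar>w j\<bar> \<le> C * b j" "0 \<le> C" "\<rho> \<in> admissible b \<epsilon>"
  shows "separately_holomorphic_on (linear_form w) (bernstein_polyellipse \<rho>)"
  unfolding separately_holomorphic_on_def
proof (intro ballI allI)
  fix z i assume "z \<in> bernstein_polyellipse \<rho>"
  then have "summable (\<lambda>j. complex_of_real (w j) * z j)"
    using assms by (intro summable_norm_cancel[OF linear_form_on_polyellipse(1)])
  then have "(\<lambda>v. linear_form w (z(i := v)))
             = (\<lambda>v. linear_form w z + complex_of_real (w i) * (v - z i))"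
    by (simp add: linear_form_update)
  then show "(\<lambda>v. linear_form w (z(i := v))) field_differentiable at (z i)"
    by (simp add: field_differentiable_add field_differentiable_mult field_differentiable_diff
        field_differentiable_const field_differentiable_ident)
qed

section \<open>Linear forms in \<open>L\<^sup>2\<close>\<close>

context polynomial_basis
begin

lemma linear_form_real_summable:
  assumes "summable (\<lambda>j. \<bar>w j\<bar>)" "y \<in> space (tensor_measure \<mu>)"
  shows "summable (\<lambda>j. cmod (complex_of_real (w j) * complex_of_real (y j)))"
proof (rule summable_comparison_test'[OF assms(1), of 0])
  fix j
  have "\<bar>y j\<bar> \<le> 1" using assms(2) by (auto simp: space_tensor abs_le_iff minus_le_iff)
  then show "norm (cmod (complex_of_real (w j) * complex_of_real (y j))) \<le> \<bar>w j\<bar>"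
    by (simp add: norm_mult mult_left_le)
qed

lemma linear_form_square_integrable:
  assumes "summable (\<lambda>j. \<bar>w j\<bar>)"
  shows "(\<lambda>y. linear_form w (\<lambda>j. complex_of_real (y j))) \<in> square_integrable (tensor_measure \<mu>)"
proof (rule bounded_square_integrable)
  have "(\<lambda>y. complex_of_real (y j)) \<in> borel_measurable (tensor_measure \<mu>)" for j
    using measurable_poly_coordinate[of j UNIV "[:0, 1:]"] by (simp add: tensor_measure_def)
  then show "(\<lambda>y. linear_form w (\<lambda>j. complex_of_real (y j))) \<in> borel_measurable (tensor_measure \<mu>)"
    unfolding linear_form_def by (intro borel_measurable_suminf borel_measurable_times) auto
next
  fix y assume y: "y \<in> space (tensor_measure \<mu>)"
  note s = linear_form_real_summable[OF assms y]
  have "cmod (linear_form w (\<lambda>j. complex_of_real (y j)))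
        \<le> (\<Sum>j. cmod (complex_of_real (w j) * complex_of_real (y j)))"
    unfolding linear_form_def by (rule summable_norm[OF s])
  also have "\<dots> \<le> (\<Sum>j. \<bar>w j\<bar>)"
  proof (rule suminf_le[OF _ s assms])
    fix j
    have "\<bar>y j\<bar> \<le> 1" using y by (auto simp: space_tensor abs_le_iff minus_le_iff)
    then show "cmod (complex_of_real (w j) * complex_of_real (y j)) \<le> \<bar>w j\<bar>"
      by (simp add: norm_mult mult_left_le)
  qed
  finally show "cmod (linear_form w (\<lambda>j. complex_of_real (y j))) \<le> (\<Sum>j. \<bar>w j\<bar>)" .
qed

text \<open>
  Since \<open>y\<^sub>j\<close> is \<open>slope\<close> times the tensor polynomial of the \<open>j\<close>-th unit index, plus a constant, the
  first-degree coefficients of a linear form are its weights times \<open>slope\<close>.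
\<close>

lemma linear_form_coeff:
  assumes "summable (\<lambda>j. \<bar>w j\<bar>)"
  shows "poly_coeff \<mu> \<psi> (\<lambda>y. linear_form w (\<lambda>j. complex_of_real (y j))) (unit_index i)
         = complex_of_real (w i * slope)"
proof -
  define M where "M = tensor_measure \<mu>"
  interpret T: prob_space M unfolding M_def by (rule prob_tensor)
  define P where "P = (\<lambda>y :: nat \<Rightarrow> real. complex_of_real (poly (\<psi> 1) (y i)))"
  define g where "g = (\<lambda>j y. complex_of_real (w j) * (complex_of_real (y j) * P y))"
  obtain B where B: "0 \<le> B" "\<And>x. x \<in> {-1..1} \<Longrightarrow> \<bar>poly (\<psi> 1) x\<bar> \<le> B"
    using poly_bound[of "\<psi> 1"] by blast
  have bound: "cmod (complex_of_real (y j) * P y) \<le> B" if "y \<in> space M" for y j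
  proof -
    have y: "\<bar>y j\<bar> \<le> 1" "y i \<in> {-1..1}"
      using that by (auto simp: M_def space_tensor abs_le_iff minus_le_iff)
    have "\<bar>y j\<bar> * \<bar>poly (\<psi> 1) (y i)\<bar> \<le> 1 * B"
      by (rule mult_mono) (use y B in auto)
    then show ?thesis by (simp add: norm_mult P_def)
  qed
  have meas: "(\<lambda>y. complex_of_real (y j) * P y) \<in> borel_measurable M" for j
    using measurable_poly_coordinate[of j UNIV "[:0, 1:]"] measurable_poly_coordinate[of i UNIV "\<psi> 1"]
    by (simp add: tensor_measure_def M_def P_def)
  have int: "integrable M (\<lambda>y. complex_of_real (y j) * P y)" for j
    by (rule T.integrable_const_bound[of _ B]) (use bound meas in auto)
  have normg: "cmod (g j y) \<le> \<bar>w j\<bar> * B" if "y \<in> space M" for j y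
    using bound[OF that, of j] unfolding g_def norm_mult[of "complex_of_real (w j)"]
    by (simp add: mult_left_mono)
  have sumB: "summable (\<lambda>j. \<bar>w j\<bar> * B)" using assms by (rule summable_mult2)
  have "poly_coeff \<mu> \<psi> (\<lambda>y. linear_form w (\<lambda>j. complex_of_real (y j))) (unit_index i)
        = (LINT y|M. (\<Sum>j. g j y))"
    unfolding poly_coeff_def L2_inner_def M_def[symmetric]
  proof (rule Bochner_Integration.integral_cong)
    fix y assume "y \<in> space M"
    then have "summable (\<lambda>j. complex_of_real (w j) * complex_of_real (y j))"
      unfolding M_def by (intro summable_norm_cancel[OF linear_form_real_summable[OF assms]])
    then show "linear_form w (\<lambda>j. complex_of_real (y j)) * cnj (tensor_poly \<psi> (unit_index i) y)
               = (\<Sum>j. g j y)"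
      unfolding linear_form_def
      by (subst suminf_mult2) (auto simp: tensor_poly_unit_index g_def P_def mult.assoc)
  qed simp
  also have "\<dots> = (\<Sum>j. (LINT y|M. g j y))"
  proof (rule integral_suminf)
    show "integrable M (g j)" for j
      unfolding g_def by (rule integrable_mult_right) (rule int)
    show "AE y in M. summable (\<lambda>j. norm (g j y))"
      by (rule AE_I2, rule summable_comparison_test'[OF sumB, of 0]) (use normg in simp)
    show "summable (\<lambda>j. LINT y|M. norm (g j y))"
    proof (rule summable_comparison_test'[OF sumB, of 0])
      fix j
      have "(LINT y|M. norm (g j y)) \<le> (LINT y|M. \<bar>w j\<bar> * B)"
        by (rule integral_mono) (use \<open>integrable M (g j)\<close> normg in auto)
      then show "norm (LINT y|M. norm (g j y)) \<le> \<bar>w j\<bar> * B"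
        by (simp add: T.prob_space)
    qed
  qed
  also have "\<dots> = (\<Sum>j. if j = i then complex_of_real (w i * slope) else 0)"
  proof (rule suminf_cong)
    fix j
    have "(LINT y|M. g j y) = complex_of_real (w j) * (LINT y|M. complex_of_real (y j) * P y)"
      unfolding g_def by (rule integral_mult_right_zero)
    then show "(LINT y|M. g j y) = (if j = i then complex_of_real (w i * slope) else 0)"
      using coordinate_coeff[of j i] by (auto simp: M_def P_def)
  qed
  also have "\<dots> = complex_of_real (w i * slope)"
    using sums_single[of i "\<lambda>_. complex_of_real (w i * slope)"] by (simp add: sums_iff)
  finally show ?thesis .
qed

lemma best_n_term_exists:
  assumes "f \<in> square_integrable (tensor_measure \<mu>)"
  shows "\<exists>g. best_n_term_approximation \<mu> \<psi> f n g"
proof -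
  have "infinite multi_indices"
    using unit_index by (metis finite_imageD finite_subset image_subsetI infinite_UNIV_nat)
  from best_projection_exists[OF tensor_poly_orthonormal assms this, of n]
  show ?thesis
    unfolding best_n_term_approximation_def n_term_index_sets_def poly_truncation_def[abs_def]
      poly_coeff_def by blast
qed

text \<open>
  Almost everywhere vanishing linear combinations have vanishing coefficients; this transfers linear
  independence in \<open>L\<^sup>2\<close> to coefficient sequences.
\<close>

lemma sum_coeff_zero:
  assumes "finite B" "B \<subseteq> square_integrable (tensor_measure \<mu>)" "\<nu> \<in> multi_indices"
    and "AE y in tensor_measure \<mu>. (\<Sum>f\<in>B. a f * f y) = 0"
  shows "(\<Sum>f\<in>B. a f * poly_coeff \<mu> \<psi> f \<nu>) = 0"
proof -
  have \<Psi>: "tensor_poly \<psi> \<nu> \<in> square_integrable (tensor_measure \<mu>)"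
    using tensor_poly_orthonormal assms(3) by (auto simp: orthonormal_family_def)
  have "(\<Sum>f\<in>B. a f * poly_coeff \<mu> \<psi> f \<nu>)
        = (LINT y|tensor_measure \<mu>. (\<Sum>f\<in>B. a f * (f y * cnj (tensor_poly \<psi> \<nu> y))))"
    unfolding poly_coeff_def L2_inner_def using assms(2) \<Psi>
    by (subst Bochner_Integration.integral_sum) (auto intro!: integrable_mult_cnj)
  also have "\<dots> = (LINT y|tensor_measure \<mu>. (\<Sum>f\<in>B. a f * f y) * cnj (tensor_poly \<psi> \<nu> y))"
    by (simp add: sum_distrib_right mult.assoc)
  also have "\<dots> = 0"
    by (rule integral_eq_zero_AE) (use assms(4) in auto)
  finally show ?thesis .
qed

end

section \<open>A family of slowly approximable linear forms\<close>

lemma linear_form_in_holomorphic_class: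
  assumes \<mu>: "polynomial_basis \<mu> \<psi>" and b: "\<forall>i. 0 \<le> b i" "summable b" and "0 \<le> C"
    and w: "\<And>j. \<bar>w j\<bar> \<le> C * b j" and C: "C * (\<epsilon> + (\<Sum>j. b j)) \<le> 1"
  shows "(\<lambda>y. linear_form w (\<lambda>j. complex_of_real (y j))) \<in> holomorphic_class \<mu> b \<epsilon>"
proof -
  have "summable (\<lambda>j. \<bar>w j\<bar>)"
    using w by (intro summable_comparison_test'[OF summable_mult[OF b(2), of C], of 0]) simp
  then have "(\<lambda>y. linear_form w (\<lambda>j. complex_of_real (y j))) \<in> square_integrable (tensor_measure \<mu>)"
    by (rule polynomial_basis.linear_form_square_integrable[OF \<mu>])
  moreover have "\<forall>\<rho>\<in>admissible b \<epsilon>. separately_holomorphic_on (linear_form w) (bernstein_polyellipse \<rho>)"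
    using linear_form_holomorphic[OF b w \<open>0 \<le> C\<close>] by blast
  moreover have "(SUP z\<in>holomorphy_region b \<epsilon>. ereal (cmod (linear_form w z))) \<le> 1"
  proof (rule SUP_least)
    fix z assume "z \<in> holomorphy_region b \<epsilon>"
    then obtain \<rho> where "\<rho> \<in> admissible b \<epsilon>" "z \<in> bernstein_polyellipse \<rho>"
      by (auto simp: holomorphy_region_def)
    from linear_form_on_polyellipse(2)[OF b w this \<open>0 \<le> C\<close>] C
    show "ereal (cmod (linear_form w z)) \<le> 1" by simp
  qed
  ultimately show ?thesis unfolding holomorphic_class_def by blast
qed

context polynomial_basis
begin

text \<open>
  Up to the nonzero factors \<open>\<beta> i\<close>, the coefficient matrix is the all-ones matrix minus half the
  identity. If \<open>a\<close> is in its left kernel, then \<open>a g\<close> is twice the sum of all weights for every \<open>g\<close>;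
  a column outside the finite set of rows involved shows that this sum is 0.
\<close>

lemma halved_family_independent:
  fixes F :: "nat \<Rightarrow> (nat \<Rightarrow> real) \<Rightarrow> complex"
  assumes K: "infinite K"
    and F: "\<And>k. k \<in> K \<Longrightarrow> F k \<in> square_integrable (tensor_measure \<mu>)"
    and coeff: "\<And>k i. k \<in> K \<Longrightarrow> i \<in> K \<Longrightarrow>
          poly_coeff \<mu> \<psi> (F k) (unit_index i) = (if k = i then 1 / 2 else 1) * \<beta> i"
    and \<beta>: "\<And>i. i \<in> K \<Longrightarrow> \<beta> i \<noteq> 0"
  shows "infinite (F ` K)" and "L2_independent (tensor_measure \<mu>) (F ` K)"
proof -
  have "inj_on F K"
  proof (rule inj_onI, rule ccontr)
    fix k l assume "k \<in> K" "l \<in> K" "F k = F l" "k \<noteq> l"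
    with coeff[of k k] coeff[of l k] \<beta>[of k] show False by auto
  qed
  with K show inf: "infinite (F ` K)" using finite_imageD by blast
  show "L2_independent (tensor_measure \<mu>) (F ` K)"
    unfolding L2_independent_def
  proof (intro allI impI ballI, elim conjE)
    fix B a g assume B: "finite B" "B \<subseteq> F ` K"
      and zero: "AE y in tensor_measure \<mu>. (\<Sum>f\<in>B. a f * f y) = 0" and "g \<in> B"
    have coeff_zero: "(\<Sum>f\<in>B. a f * poly_coeff \<mu> \<psi> f (unit_index i)) = 0" for i
      using B F zero by (intro sum_coeff_zero unit_index) auto
    have pattern: "poly_coeff \<mu> \<psi> f (unit_index i) = (if f = F i then 1 / 2 else 1) * \<beta> i"
      if f: "f \<in> B" and i: "i \<in> K" for f i
    proof -
      obtain k where "k \<in> K" "f = F k" using f B by blast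
      then show ?thesis
        using coeff[of k i] i inj_onD[OF \<open>inj_on F K\<close>, of k i] by auto
    qed
    \<comment> \<open>If \<open>F i\<close> is not in \<open>B\<close>, all functions in \<open>B\<close> have the same coefficient \<open>\<beta> i\<close>.\<close>
    obtain i where i: "i \<in> K" "F i \<notin> B"
      using inf B(1) by (metis finite_subset image_subsetI)
    have "(\<Sum>f\<in>B. a f) * \<beta> i = (\<Sum>f\<in>B. a f * poly_coeff \<mu> \<psi> f (unit_index i))"
      unfolding sum_distrib_right
    proof (rule sum.cong[OF refl])
      fix f assume "f \<in> B"
      moreover from this i have "f \<noteq> F i" by blast
      ultimately show "a f * \<beta> i = a f * poly_coeff \<mu> \<psi> f (unit_index i)"
        using pattern i by simp
    qed
    then have total: "(\<Sum>f\<in>B. a f) = 0" using coeff_zero \<beta> i by simp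
    obtain k where k: "k \<in> K" "g = F k" using \<open>g \<in> B\<close> B by blast
    have "0 = (\<Sum>f\<in>B. a f * poly_coeff \<mu> \<psi> f (unit_index k))" by (simp add: coeff_zero)
    also have "\<dots> = (\<Sum>f\<in>B. (a f - (if f = g then a f / 2 else 0)) * \<beta> k)"
      by (rule sum.cong) (auto simp: pattern k(1) k(2)[symmetric] algebra_simps)
    also have "\<dots> = (\<Sum>f\<in>B. a f - (if f = g then a f / 2 else 0)) * \<beta> k"
      by (simp add: sum_distrib_right)
    also have "(\<Sum>f\<in>B. a f - (if f = g then a f / 2 else 0)) = - (a g / 2)"
      using B(1) \<open>g \<in> B\<close> by (simp add: sum_subtractf total)
    finally show "a g = 0" using \<beta>[OF k(1)] by simp
  qed
qed

text \<open>
  If the quotients were eventually below \<open>m\<close>, the lower bound for truncation errors would be violated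
  at the infinitely many \<open>n\<close> for which \<open>2 n\<close> terms of \<open>c\<close> exceed a suitable multiple of
  \<open>n powr (- 1 / r)\<close>: \<open>n\<close> such coefficients have a root of the sum of squares of order
  \<open>n powr (1 / 2 - 1 / r)\<close>.
\<close>

lemma limsup_best_n_term_error:
  assumes f: "f \<in> square_integrable (tensor_measure \<mu>)"
    and c: "c \<longlonglongrightarrow> 0" "c \<notin> weak_lp_space r" and "0 < r" and "0 < \<delta>"
    and coeff: "\<And>i. \<delta> * \<bar>c i\<bar> \<le> cmod (poly_coeff \<mu> \<psi> f (unit_index i))"
    and best: "\<And>n. best_n_term_approximation \<mu> \<psi> f n (fn n)"
  shows "limsup (\<lambda>n. ereal (L2_norm (tensor_measure \<mu>) (\<lambda>y. f y - fn n y)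
           / real n powr (1 / 2 - 1 / r))) = \<infinity>"
proof (rule ccontr)
  define err where "err n = L2_norm (tensor_measure \<mu>) (\<lambda>y. f y - fn n y)" for n
  assume "limsup (\<lambda>n. ereal (L2_norm (tensor_measure \<mu>) (\<lambda>y. f y - fn n y)
           / real n powr (1 / 2 - 1 / r))) \<noteq> \<infinity>"
  then obtain m :: nat where "limsup (\<lambda>n. ereal (err n / real n powr (1 / 2 - 1 / r))) < ereal (real m)"
    using less_PInf_Ex_of_nat unfolding err_def by blast
  then have "\<forall>\<^sub>F n in sequentially. ereal (err n / real n powr (1 / 2 - 1 / r)) < ereal (real m)"
    by (rule Limsup_lessD)
  then obtain N where N: "\<And>n. N \<le> n \<Longrightarrow> err n / real n powr (1 / 2 - 1 / r) < real m"
    by (auto simp: eventually_sequentially)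
  have "0 < (real m + 1) / \<delta>" using \<open>0 < \<delta>\<close> by simp
  from many_large_terms_if_not_weak_lp[OF c(1) \<open>0 < r\<close> c(2) this, of "Suc N"]
  obtain n T where n: "Suc N \<le> n" and T: "finite T" "card T = 2 * n"
    and large: "\<And>i. i \<in> T \<Longrightarrow> (real m + 1) / \<delta> * real n powr (- 1 / r) < \<bar>c i\<bar>"
    by blast
  define s where "s = (real m + 1) * real n powr (- 1 / r)"
  have "0 \<le> s" by (simp add: s_def)
  have coeff_large: "s\<^sup>2 \<le> (cmod (L2_inner (tensor_measure \<mu>) f (tensor_poly \<psi> \<nu>)))\<^sup>2"
    if \<nu>: "\<nu> \<in> unit_index ` T" for \<nu>
  proof -
    obtain i where i: "i \<in> T" "\<nu> = unit_index i" using \<nu> by blast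
    have "s \<le> \<delta> * \<bar>c i\<bar>"
      using large[OF i(1)] \<open>0 < \<delta>\<close> by (simp add: s_def field_simps)
    also have "\<dots> \<le> cmod (L2_inner (tensor_measure \<mu>) f (tensor_poly \<psi> \<nu>))"
      using coeff[of i] by (simp add: i(2) poly_coeff_def)
    finally show ?thesis using \<open>0 \<le> s\<close> by (rule power_mono)
  qed
  obtain S where S: "S \<in> n_term_index_sets n" "fn n = poly_truncation \<mu> \<psi> f S"
    using best[of n] unfolding best_n_term_approximation_def by blast
  have "real n * s\<^sup>2 \<le> (err n)\<^sup>2"
    unfolding err_def S(2) poly_truncation_def poly_coeff_def
  proof (rule projection_error_lower_bound[OF tensor_poly_orthonormal f])
    show "card (unit_index ` T) = 2 * n"
      using T card_image[OF inj_on_subset[OF unit_index(2) subset_UNIV]] by simp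
  qed (use S(1) T unit_index(1) coeff_large in \<open>auto simp: n_term_index_sets_def\<close>)
  moreover have "real n * s\<^sup>2 = ((real m + 1) * real n powr (1 / 2 - 1 / r))\<^sup>2"
  proof -
    have "real n powr (1 / 2 - 1 / r) = real n powr (1 / 2) * real n powr (- 1 / r)"
      by (simp add: powr_add[symmetric])
    moreover have "(real n powr (1 / 2))\<^sup>2 = real n" by (simp add: powr_half_sqrt)
    ultimately show ?thesis by (simp add: s_def power_mult_distrib)
  qed
  ultimately have "((real m + 1) * real n powr (1 / 2 - 1 / r))\<^sup>2 \<le> (err n)\<^sup>2" by simp
  then have "(real m + 1) * real n powr (1 / 2 - 1 / r) \<le> err n"
    by (rule power2_le_imp_le) (simp add: err_def L2_norm_def)
  then have "real m + 1 \<le> err n / real n powr (1 / 2 - 1 / r)"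
    using n by (simp add: pos_le_divide_eq)
  with N[of n] n show False by simp
qed

end

theorem theorem5p6:
  fixes \<mu> :: "real measure" and \<psi> :: "nat \<Rightarrow> real poly"
    and b :: "nat \<Rightarrow> real" and \<epsilon> p r :: real
  assumes "prob_space \<mu>"
    and "sets \<mu> = sets (restrict_space borel {-1..1})"
    and "orthonormal_polynomials \<mu> \<psi>"
    and "\<forall>i. 0 \<le> b i"
    and "0 < \<epsilon>"
    and "0 < p" and "p \<le> 1"
    and "b \<in> lp_space p"
    and "0 < r" and "r < p"
    and "b \<notin> weak_lp_space r"
  shows "\<exists>A. A \<subseteq> holomorphic_class \<mu> b \<epsilon> \<and> infinite A \<and>
           L2_independent (tensor_measure \<mu>) A \<and>
           (\<forall>f\<in>A. (\<forall>n. \<exists>g. best_n_term_approximation \<mu> \<psi> f n g) \<and>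
              (\<forall>fn. (\<forall>n. best_n_term_approximation \<mu> \<psi> f n (fn n)) \<longrightarrow>
                 limsup (\<lambda>n. ereal (L2_norm (tensor_measure \<mu>) (\<lambda>y. f y - fn n y)
                                     / real n powr (1 / 2 - 1 / r))) = \<infinity>))"
proof -
  interpret polynomial_basis \<mu> \<psi> by (rule polynomial_basis.intro) (fact assms)+
  have b: "\<forall>i. 0 \<le> b i" "summable b"
    using assms(4) summable_if_lp[OF assms(8,6,7)] by auto
  have null: "b \<longlonglongrightarrow> 0" by (rule summable_LIMSEQ_zero[OF b(2)])
  define K where "K = {i. b i \<noteq> 0}"
  have "infinite K"
  proof
    assume "finite K"
    obtain n T where n: "Suc (card K) \<le> n" and T: "card T = 2 * n"
      and large: "\<forall>j\<in>T. 1 * real n powr (- 1 / r) < \<bar>b j\<bar>"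
      using many_large_terms_if_not_weak_lp[OF null assms(9,11), of 1 "Suc (card K)"] by auto
    have "T \<subseteq> K"
    proof
      fix j assume "j \<in> T"
      have "0 \<le> real n powr (- 1 / r)" by simp
      with large \<open>j \<in> T\<close> show "j \<in> K" unfolding K_def by force
    qed
    then have "card T \<le> card K" by (rule card_mono[OF \<open>finite K\<close>])
    with n T show False by simp
  qed
  define C where "C = 1 / (\<epsilon> + (\<Sum>j. b j))"
  have "0 < \<epsilon> + (\<Sum>j. b j)" using assms(5) suminf_nonneg[OF b(2)] b(1) by (simp add: add_pos_nonneg)
  then have C: "0 < C" "C * (\<epsilon> + (\<Sum>j. b j)) \<le> 1" by (auto simp: C_def)
  \<comment> \<open>Halving one weight gives infinitely many different functions whose coefficients are all still at
    least half of those of the undisturbed form.\<close>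
  define w where "w k j = C * (if k = j then 1 / 2 else 1) * b j" for k j :: nat
  define F where "F k y = linear_form (w k) (\<lambda>j. complex_of_real (y j))" for k and y :: "nat \<Rightarrow> real"
  have w_le: "\<bar>w k j\<bar> \<le> C * b j" for k j
    using C(1) b(1) by (auto simp: w_def abs_mult)
  have w_summable: "summable (\<lambda>j. \<bar>w k j\<bar>)" for k
    using w_le by (intro summable_comparison_test'[OF summable_mult[OF b(2), of C], of 0]) simp
  have F_L2: "F k \<in> square_integrable (tensor_measure \<mu>)" for k
    unfolding F_def[abs_def] by (rule linear_form_square_integrable[OF w_summable])
  have F_coeff: "poly_coeff \<mu> \<psi> (F k) (unit_index i) = complex_of_real (w k i * slope)" for k i
    unfolding F_def[abs_def] by (rule linear_form_coeff[OF w_summable])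
  have "F k \<in> holomorphic_class \<mu> b \<epsilon>" for k
    unfolding F_def[abs_def]
    by (rule linear_form_in_holomorphic_class[OF polynomial_basis_axioms b _ w_le C(2)]) (use C in simp)
  then have in_class: "F ` K \<subseteq> holomorphic_class \<mu> b \<epsilon>" by blast
  have "infinite (F ` K)" "L2_independent (tensor_measure \<mu>) (F ` K)"
    by (rule halved_family_independent[of K F "\<lambda>i. complex_of_real (C * b i * slope)"];
        use \<open>infinite K\<close> F_L2 F_coeff C slope_nonzero in \<open>auto simp: w_def K_def\<close>)+
  moreover have "limsup (\<lambda>n. ereal (L2_norm (tensor_measure \<mu>) (\<lambda>y. F k y - fn n y)
                                     / real n powr (1 / 2 - 1 / r))) = \<infinity>"
    if "\<forall>n. best_n_term_approximation \<mu> \<psi> (F k) n (fn n)" for k fn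
  proof (rule limsup_best_n_term_error[OF F_L2 null assms(11,9)])
    show "0 < C / 2 * \<bar>slope\<bar>" using C slope_nonzero by simp
    show "C / 2 * \<bar>slope\<bar> * \<bar>b i\<bar> \<le> cmod (poly_coeff \<mu> \<psi> (F k) (unit_index i))" for i
      unfolding F_coeff norm_of_real using C b(1) by (auto simp: w_def abs_mult)
  qed (use that in blast)
  ultimately show ?thesis
    using in_class best_n_term_exists[OF F_L2] by (intro exI[of _ "F ` K"]) auto
qed

end
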